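(* Let $R^0$ be a finite-dimensional $\mathbb{Q}$-algebra equipped with an anti-involution $*$ (a $\mathbb{Q}$-linear map with $(xy)^*=y^*x^*$ and $(x^* )^*=x$ for all $x,y\in R^0$), and let $R\subseteq R^0$ be an order of $R^0$. Assume that $\mathrm{Tr}_{R^0/\mathbb{Q}}(xx^* )>0$ for every nonzero $x\in R^0$. Suppose \[1=i_1+\dots+i_r,\] where each $i_\nu$ is an indecomposable element of $I^*(R)$ and $i_\nu\perp i_{\nu'}$ whenever $\nu\neq\nu'$. Then the set $\{i_\nu\}_\nu$ is uniquely determined; that is, for any other such decomposition $1=j_1+\dots+j_s$ into pairwise orthogonal indecomposable elements of $I^*(R)$, one has $\{j_1,\dots,j_s\}=\{i_1,\dots,i_r\}$.
   Context: An order of $R^0$ is a subring of $R^0$ which is a $\mathbb{Z}$-lattice of full rank in $R^0$. $\mathrm{Tr}_{R^0/\mathbb{Q}}$ denotes the (left) trace: $\mathrm{Tr}_{R^0/\mathbb{Q}}(a)$ is the trace of the $\mathbb{Q}$-linear map $x\mapsto ax$ on $R^0$. $I(R)=\{i\in R: i^2=i\}$ and $I^*(R)=\{i\in I(R): i^*=i\}$ (Hermitian idempotents). Elements $x,y\in R$ are orthogonal, written $x\perp y$, if $xy^*=0$. A nonzero $i\in I^*(R)$ is indecomposable if whenever $i=j+k$ with $j,k\in I^*(R)$ and $j\perp k$, either $j=0$ or $k=0$. *)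

theory Defs
  imports Complex_Main
begin

definition (in finite_dimensional_vector_space) linear_trace :: "('b \<Rightarrow> 'b) \<Rightarrow> 'a" where
  "linear_trace f = (\<Sum>b\<in>Basis. representation Basis (f b) b)"

lemma (in finite_dimensional_vector_space) linear_trace_basis_independent:
  assumes f: "Vector_Spaces.linear scale scale f"
    and B: "independent B" "span B = UNIV"
  shows "linear_trace f = (\<Sum>b\<in>B. representation B (f b) b)"
proof -
  interpret f: Vector_Spaces.linear scale scale f by (rule f)
  have finB: "finite B" using B(1) by (rule finiteI_independent)
  let ?r = "representation Basis" and ?s = "representation B"
  have r: "v = (\<Sum>b\<in>Basis. ?r v b *s b)" for v
    using sum_representation_eq[OF independent_Basis _ finite_Basis, of v] span_Basis by simp
  have s: "v = (\<Sum>b\<in>B. ?s v b *s b)" for v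
    using sum_representation_eq[OF B(1) _ finB, of v] B(2) by simp
  have rsum: "?r (\<Sum>c\<in>B. g c *s h c) b = (\<Sum>c\<in>B. g c * ?r (h c) b)" for g h b
    by (simp add: representation_sum[OF independent_Basis] representation_scale[OF independent_Basis] span_Basis)
  have ssum: "?s (\<Sum>c\<in>Basis. g c *s h c) b = (\<Sum>c\<in>Basis. g c * ?s (h c) b)" for g h b
    by (simp add: representation_sum[OF B(1)] representation_scale[OF B(1)] B(2))
  have "linear_trace f = (\<Sum>b\<in>Basis. \<Sum>c\<in>B. ?s (f b) c * ?r c b)"
    unfolding linear_trace_def
  proof (rule sum.cong[OF refl])
    fix b
    show "?r (f b) b = (\<Sum>c\<in>B. ?s (f b) c * ?r c b)"
      using rsum[of "?s (f b)" "\<lambda>c. c" b] s[of "f b"] by simp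
  qed
  also have "\<dots> = (\<Sum>c\<in>B. \<Sum>b\<in>Basis. ?r c b * ?s (f b) c)"
    by (subst sum.swap) (simp add: mult.commute)
  also have "\<dots> = (\<Sum>c\<in>B. ?s (f c) c)"
  proof (rule sum.cong[OF refl])
    fix c
    have "f c = (\<Sum>b\<in>Basis. ?r c b *s f b)"
      by (subst r[of c]) (simp add: f.sum f.scale)
    then show "(\<Sum>b\<in>Basis. ?r c b * ?s (f b) c) = ?s (f c) c"
      using ssum[of "?r c" f c] by simp
  qed
  finally show ?thesis .
qed

text \<open>
  The algebra is the whole type \<open>'a\<close>.  The sort \<open>{ring, monoid_mult}\<close> is that of
  associative unital rings in which \<open>1 = 0\<close> is not excluded.
\<close>

locale rat_algebra = finite_dimensional_vector_space scale Basis
  for scale :: "rat \<Rightarrow> 'a::{ring, monoid_mult} \<Rightarrow> 'a" and Basis :: "'a set" +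
  assumes scale_mult_left: "scale c x * y = scale c (x * y)"
    and scale_mult_right: "x * scale c y = scale c (x * y)"
begin

definition left_trace :: "'a \<Rightarrow> rat" where
  "left_trace a = linear_trace (\<lambda>x. a * x)"

lemma linear_mult_left: "Vector_Spaces.linear scale scale (\<lambda>x. a * x)"
  by unfold_locales (simp_all add: distrib_left scale_mult_right)

definition int_scale :: "int \<Rightarrow> 'a \<Rightarrow> 'a" where
  "int_scale n x = scale (of_int n) x"

lemma module_int_scale: "module int_scale"
  by unfold_locales
    (simp_all add: int_scale_def scale_right_distrib scale_left_distrib)

definition full_lattice :: "'a set \<Rightarrow> bool" where
  "full_lattice L \<longleftrightarrow> (\<exists>S. finite S \<and> L = module.span int_scale S) \<and> span L = UNIV"

definition is_order :: "'a set \<Rightarrow> bool" where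
  "is_order R \<longleftrightarrow>
     1 \<in> R \<and> (\<forall>x\<in>R. \<forall>y\<in>R. x - y \<in> R) \<and> (\<forall>x\<in>R. \<forall>y\<in>R. x * y \<in> R) \<and> full_lattice R"

end

locale rat_algebra_involution = rat_algebra scale Basis
  for scale :: "rat \<Rightarrow> 'a::{ring, monoid_mult} \<Rightarrow> 'a" and Basis :: "'a set" +
  fixes star :: "'a \<Rightarrow> 'a"
  assumes star_linear: "Vector_Spaces.linear scale scale star"
    and star_mult: "star (x * y) = star y * star x"
    and star_star: "star (star x) = x"

definition idempotents :: "'a::ring set \<Rightarrow> 'a set" where
  "idempotents R = {i \<in> R. i * i = i}"

definition hermitian_idempotents :: "('a::ring \<Rightarrow> 'a) \<Rightarrow> 'a set \<Rightarrow> 'a set" where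
  "hermitian_idempotents star R = {i \<in> idempotents R. star i = i}"

definition orth :: "('a::ring \<Rightarrow> 'a) \<Rightarrow> 'a \<Rightarrow> 'a \<Rightarrow> bool" where
  "orth star x y \<longleftrightarrow> x * star y = 0"

definition indecomposable :: "('a::ring \<Rightarrow> 'a) \<Rightarrow> 'a set \<Rightarrow> 'a \<Rightarrow> bool" where
  "indecomposable star R i \<longleftrightarrow>
     i \<in> hermitian_idempotents star R \<and> i \<noteq> 0 \<and>
     (\<forall>j\<in>hermitian_idempotents star R. \<forall>k\<in>hermitian_idempotents star R.
        i = j + k \<and> orth star j k \<longrightarrow> j = 0 \<or> k = 0)"

text \<open>A family \<open>i\<^sub>1, \<dots>, i\<^sub>r\<close> is a function on \<open>nat\<close>; only its values on \<open>{1..r}\<close> matter.\<close>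

definition indecomposable_decomposition ::
    "('a::{ring, monoid_mult} \<Rightarrow> 'a) \<Rightarrow> 'a set \<Rightarrow> nat \<Rightarrow> (nat \<Rightarrow> 'a) \<Rightarrow> bool" where
  "indecomposable_decomposition star R r i \<longleftrightarrow>
     1 = (\<Sum>\<nu>=1..r. i \<nu>) \<and>
     (\<forall>\<nu>\<in>{1..r}. indecomposable star R (i \<nu>)) \<and>
     (\<forall>\<nu>\<in>{1..r}. \<forall>\<nu>'\<in>{1..r}. \<nu> \<noteq> \<nu>' \<longrightarrow> orth star (i \<nu>) (i \<nu>'))"

end

theory Submission
  imports Defs
begin

text \<open>
  Any two Hermitian idempotents \<open>i, j\<close> of the order commute.  Right multiplication by a Hermitian
  idempotent is an orthogonal projection for \<open>q(x) = Tr(x x\<^sup>*)\<close>, so \<open>q\<close> decreases along the powers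
  of \<open>a = i j i\<close>; its values there have bounded denominator, so \<open>a\<^sup>n\<^sup>+\<^sup>1 = a\<^sup>n\<close> for some \<open>n\<close>.
  As \<open>a\<close> is Hermitian and \<open>q\<close> is definite, \<open>a\<^sup>2 = a\<close>, whence \<open>q(i j - i j i) = Tr(a - a\<^sup>2) = 0\<close> and
  \<open>i j = i j i\<close> is Hermitian.  For commuting indecomposable \<open>i, j\<close> the decomposition
  \<open>i = i j + i (1 - j)\<close> and its mirror image leave only \<open>i = j\<close> or \<open>i j = 0\<close>.
\<close>

section \<open>Linearity of the trace and its denominators on an order\<close>

lemma (in finite_dimensional_vector_space) linear_trace_add:
  "linear_trace (\<lambda>x. f x + g x) = linear_trace f + linear_trace g"
  by (simp add: linear_trace_def representation_add independent_Basis span_Basis sum.distrib)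

lemma (in finite_dimensional_vector_space) linear_trace_scale:
  "linear_trace (\<lambda>x. c *s f x) = c * linear_trace f"
  by (simp add: linear_trace_def representation_scale independent_Basis span_Basis sum_distrib_left)

lemma finite_rat_common_denominator:
  fixes A :: "rat set"
  assumes "finite A"
  shows "\<exists>N::int. N > 0 \<and> (\<forall>a\<in>A. of_int N * a \<in> \<int>)"
  using assms
proof induction
  case empty
  show ?case by (intro exI[of _ 1]) simp
next
  case (insert a A)
  then obtain N :: int where N: "N > 0" "\<forall>b\<in>A. of_int N * b \<in> \<int>" by blast
  obtain p d where d: "quotient_of a = (p, d)" by fastforce
  then have "d > 0" and a: "a = of_int p / of_int d"
    by (auto intro: quotient_of_denom_pos quotient_of_div)
  have "of_int (d * N) * a = of_int (p * N)"
    using \<open>d > 0\<close> by (simp add: a)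
  moreover have "of_int (d * N) * b \<in> \<int>" if "b \<in> A" for b
    using N(2) that by (simp add: mult.assoc)
  ultimately show ?case
    using N(1) \<open>d > 0\<close> by (intro exI[of _ "d * N"]) (auto simp del: of_int_mult)
qed

context rat_algebra
begin

lemma left_trace_add: "left_trace (x + y) = left_trace x + left_trace y"
  by (simp add: left_trace_def distrib_right linear_trace_add)

lemma left_trace_scale: "left_trace (scale c x) = c * left_trace x"
  by (simp add: left_trace_def scale_mult_left linear_trace_scale)

lemma left_trace_zero [simp]: "left_trace 0 = 0"
  using left_trace_add[of 0 0] by simp

text \<open>The trace is additive and respects integer scaling, so a common denominator of its
  values on finitely many generators of \<open>R\<close> serves all of \<open>R\<close>.\<close>

lemma order_trace_common_denominator:
  assumes "is_order R"
  obtains N :: int where "N > 0" "\<And>x. x \<in> R \<Longrightarrow> of_int N * left_trace x \<in> \<int>"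
proof -
  interpret Z: module int_scale by (rule module_int_scale)
  obtain S where S: "finite S" "R = Z.span S"
    using assms by (auto simp: is_order_def full_lattice_def)
  obtain N :: int where N: "N > 0" "\<forall>a\<in>left_trace ` S. of_int N * a \<in> \<int>"
    using finite_rat_common_denominator S(1) by blast
  have "of_int N * left_trace x \<in> \<int>" if "x \<in> Z.span S" for x
    using that
  proof (induction rule: Z.span_induct_alt)
    case base
    show ?case by simp
  next
    case (step c s y)
    have "of_int N * left_trace (int_scale c s + y)
        = of_int c * (of_int N * left_trace s) + of_int N * left_trace y"
      by (simp add: int_scale_def left_trace_add left_trace_scale algebra_simps)
    then show ?case
      using step N(2) by simp
  qed
  with N(1) S(2) that show thesis by blast
qed

lemma is_order_power:
  assumes "is_order R" "x \<in> R"
  shows "x ^ n \<in> R"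
  using assms by (induction n) (auto simp: is_order_def)

end

section \<open>The definite form of a positive involution\<close>

locale positive_rat_algebra_involution = rat_algebra_involution scale Basis star
  for scale :: "rat \<Rightarrow> 'a::{ring, monoid_mult} \<Rightarrow> 'a" and Basis :: "'a set" and star :: "'a \<Rightarrow> 'a" +
  assumes trace_pos: "x \<noteq> 0 \<Longrightarrow> left_trace (x * star x) > 0"
begin

sublocale star: Vector_Spaces.linear scale scale star
  by (rule star_linear)

lemma star_one [simp]: "star 1 = 1"
  by (metis star_mult star_star mult_1_right)

lemma star_power: "star (x ^ n) = star x ^ n"
  by (induction n) (simp_all add: star_mult power_commutes)

lemma trace_nonneg: "left_trace (x * star x) \<ge> 0"
  using trace_pos[of x] by (cases "x = 0") auto

lemma mult_star_eq_0D: "x * star x = 0 \<Longrightarrow> x = 0"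
  using trace_pos[of x] by auto

text \<open>Pythagoras: the cross terms vanish, since
  \<open>e * star (x - x * e) = e * star x - e * e * star x = 0\<close>.\<close>

lemma trace_projection:
  assumes "e * e = e" "star e = e"
  shows "left_trace (x * star x)
    = left_trace ((x * e) * star (x * e)) + left_trace ((x - x * e) * star (x - x * e))"
proof -
  have e: "y * e * e = y * e" for y
    by (simp add: mult.assoc assms(1))
  have "x * star x = (x * e) * star (x * e) + (x - x * e) * star (x - x * e)"
    by (simp add: star_mult star.diff assms(2) algebra_simps e flip: mult.assoc)
  then show ?thesis
    by (metis left_trace_add)
qed

lemma trace_projection_le:
  assumes "e * e = e" "star e = e"
  shows "left_trace ((x * e) * star (x * e)) \<le> left_trace (x * star x)"
  using trace_projection[OF assms, of x] trace_nonneg[of "x - x * e"] by simp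

text \<open>If the projection loses no length, the remainder \<open>x - x * e\<close> has length 0
  and vanishes by definiteness.\<close>

lemma trace_projection_ge_imp_eq:
  assumes "e * e = e" "star e = e"
    and "left_trace ((x * e) * star (x * e)) \<ge> left_trace (x * star x)"
  shows "x * e = x"
  using trace_projection[OF assms(1,2), of x] trace_pos[of "x - x * e"] assms(3) by force

text \<open>The exponent drops one at a time: for the Hermitian \<open>w = a ^ Suc n\<close>, the
  square \<open>w * w\<close> begins with the factor \<open>a ^ Suc (Suc n)\<close>. Hence
  \<open>z * w * star (z * w) = 0\<close>, and definiteness gives \<open>z * w = 0\<close>.\<close>

lemma hermitian_power_cancel:
  assumes "star a = a" "z * a ^ Suc n = 0"
  shows "z * a = 0"
  using assms(2)
proof (induction n)
  case 0
  then show ?case by simp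
next
  case (Suc n)
  define w where "w = a ^ Suc n"
  have star_w: "star w = w"
    by (simp only: w_def star_power assms(1))
  have "w * w = a ^ Suc (Suc n) * a ^ n"
    unfolding w_def power_add[symmetric] by (rule arg_cong[where f = "power a"]) simp
  then have "z * (w * w) = 0"
    using Suc.prems by (simp only: mult.assoc[symmetric] mult_zero_left)
  then have "(z * w) * star (z * w) = 0"
    by (simp only: star_mult star_w mult.assoc[symmetric] mult_zero_left)
  then have "z * a ^ Suc n = 0"
    unfolding w_def by (rule mult_star_eq_0D)
  then show ?case by (rule Suc.IH)
qed

lemma hermitian_idempotents_commute:
  assumes R: "is_order R"
    and i: "i \<in> hermitian_idempotents star R" and j: "j \<in> hermitian_idempotents star R"
  shows "i * j = j * i"
proof -
  have i': "i \<in> R" "i * i = i" "star i = i" and j': "j \<in> R" "j * j = j" "star j = j"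
    using i j by (auto simp: hermitian_idempotents_def idempotents_def)
  define a where "a = i * j * i"
  have "a \<in> R"
    using R i'(1) j'(1) by (auto simp: a_def is_order_def)
  have star_a: "star a = a"
    by (simp add: a_def star_mult i'(3) j'(3) mult.assoc)
  define q where "q x = left_trace (x * star x)" for x
  obtain N :: int where N: "N > 0" "\<And>x. x \<in> R \<Longrightarrow> of_int N * left_trace x \<in> \<int>"
    using order_trace_common_denominator[OF R] by blast
  \<comment> \<open>Clearing denominators makes the lengths of the powers natural numbers, so a
    least one exists.\<close>
  have "\<exists>k::nat. of_int N * q (a ^ n) = of_nat k" for n
  proof -
    have "a ^ n * star (a ^ n) \<in> R"
      using is_order_power[OF R \<open>a \<in> R\<close>, of "n + n"] by (simp add: star_power star_a power_add)
    then have "of_int N * q (a ^ n) \<in> \<int>"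
      unfolding q_def by (rule N(2))
    moreover have "of_int N * q (a ^ n) \<ge> 0"
      using N(1) trace_nonneg by (simp add: q_def)
    ultimately show ?thesis
      by (metis Ints_cases of_int_0_le_iff of_int_of_nat_eq zero_le_imp_eq_int)
  qed
  then obtain k :: "nat \<Rightarrow> nat" where k: "\<And>n. of_int N * q (a ^ n) = of_nat (k n)"
    by metis
  \<comment> \<open>At a power of least length, one more factor \<open>a\<close> cannot shorten
    it.\<close>
  obtain n where n: "\<And>m. k n \<le> k m"
    using ex_has_least_nat[of "\<lambda>_. True" _ k] by auto
  define x where "x = a ^ n"
  have "rat_of_nat (k n) \<le> of_nat (k (Suc n))"
    using n by simp
  then have "q (a ^ n) \<le> q (a ^ Suc n)"
    using N(1) by (simp add: mult_le_cancel_left_pos del: power_Suc flip: k)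
  then have "q x \<le> q (x * i * j * i)"
    by (simp add: x_def a_def power_commutes mult.assoc flip: power_Suc2)
  \<comment> \<open>Multiplication by \<open>a\<close> is three successive projections; as the total
    length does not drop, each of the first two fixes its argument.\<close>
  moreover have "q (x * i * j * i) \<le> q (x * i * j)" "q (x * i * j) \<le> q (x * i)" "q (x * i) \<le> q x"
    using trace_projection_le i' j' by (auto simp: q_def)
  ultimately have "q x \<le> q (x * i)" "q (x * i) \<le> q (x * i * j)"
    by auto
  then have xi: "x * i = x" and "x * i * j = x * i"
    using trace_projection_ge_imp_eq[OF i'(2,3)] trace_projection_ge_imp_eq[OF j'(2,3)]
    by (auto simp: q_def)
  then have "x * a = x"
    by (simp add: a_def flip: mult.assoc)
  \<comment> \<open>The extra factor \<open>a\<close> covers \<open>n = 0\<close>, as cancellation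
    needs a positive exponent.\<close>
  then have "(1 - a) * a ^ Suc n = 0"
    by (simp add: x_def algebra_simps power_commutes flip: mult.assoc)
  then have "(1 - a) * a = 0"
    by (rule hermitian_power_cancel[OF star_a])
  then have aa: "a * a = a"
    by (simp add: algebra_simps)
  \<comment> \<open>Here \<open>i * j * star (i * j) = a\<close>, and the other three products all
    equal \<open>a * a\<close>.\<close>
  have "(i * j - a) * star (i * j - a) = a - a * a"
  proof -
    have ii: "y * i * i = y * i" and jj: "y * j * j = y * j" for y
      by (simp_all add: mult.assoc i'(2) j'(2))
    show ?thesis
      by (simp add: a_def star_mult star.diff i' j' algebra_simps ii jj flip: mult.assoc)
  qed
  then have "i * j = a"
    using mult_star_eq_0D[of "i * j - a"] aa by simp
  then show ?thesis
    using star_a by (metis star_mult i'(3) j'(3))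
qed

section \<open>Comparison of indecomposable idempotents\<close>

lemma indecomposable_mult_eq:
  assumes R: "is_order R"
    and i: "indecomposable star R i" and j: "j \<in> hermitian_idempotents star R"
    and "i * j \<noteq> 0"
  shows "i * j = i"
proof -
  have ih: "i \<in> hermitian_idempotents star R"
    using i by (simp add: indecomposable_def)
  have i': "i \<in> R" "i * i = i" "star i = i" and j': "j \<in> R" "j * j = j" "star j = j"
    using ih j by (auto simp: hermitian_idempotents_def idempotents_def)
  have ij: "j * i = i * j"
    using hermitian_idempotents_commute[OF R ih j] by simp
  \<comment> \<open>Commutation makes \<open>p\<close> a Hermitian idempotent below
    \<open>i\<close>, so \<open>i = p + (i - p)\<close> is an orthogonal splitting to which
    indecomposability applies.\<close>
  define p where "p = i * j"
  have ip: "i * p = p" and jp: "j * p = p"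
    by (simp_all add: p_def i'(2) flip: mult.assoc) (simp add: ij mult.assoc j'(2))
  have pi: "p * i = p"
    by (simp add: p_def mult.assoc ij) (simp add: i'(2) flip: mult.assoc)
  have pp: "p * p = p"
    using ip jp by (simp add: p_def mult.assoc)
  have star_p: "star p = p"
    by (simp add: p_def star_mult i' j' ij)
  have "p \<in> R" "i - p \<in> R"
    using R i'(1) j'(1) by (auto simp: p_def is_order_def)
  then have "p \<in> hermitian_idempotents star R" "i - p \<in> hermitian_idempotents star R"
    by (simp_all add: hermitian_idempotents_def idempotents_def star.diff star_p i'
        left_diff_distrib right_diff_distrib pp ip pi)
  moreover have "orth star p (i - p)" "i = p + (i - p)"
    by (simp_all add: orth_def star.diff star_p i' right_diff_distrib pp pi)
  ultimately have "p = 0 \<or> i - p = 0"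
    using i unfolding indecomposable_def by blast
  then have "i * j = 0 \<or> i = i * j"
    by (simp add: p_def)
  with assms(4) show ?thesis by simp
qed

text \<open>Each factor absorbs the other, so the common product is both \<open>i\<close> and
  \<open>j\<close>.\<close>

lemma indecomposable_eq:
  assumes R: "is_order R"
    and i: "indecomposable star R i" and j: "indecomposable star R j"
    and "i * j \<noteq> 0"
  shows "i = j"
proof -
  have h: "i \<in> hermitian_idempotents star R" "j \<in> hermitian_idempotents star R"
    using i j by (simp_all add: indecomposable_def)
  have "i * j = j * i"
    by (rule hermitian_idempotents_commute[OF R h])
  then show ?thesis
    using indecomposable_mult_eq[OF R i h(2)] indecomposable_mult_eq[OF R j h(1)] assms(4) by simp
qed

lemma indecomposable_decomposition_subset:
  assumes R: "is_order R"
    and i: "indecomposable_decomposition star R r i"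
    and j: "indecomposable_decomposition star R s j"
  shows "j ` {1..s} \<subseteq> i ` {1..r}"
proof clarify
  fix m assume "m \<in> {1..s}"
  then have jm: "indecomposable star R (j m)"
    using j by (simp add: indecomposable_decomposition_def)
  \<comment> \<open>Multiplying \<open>1 = (\<Sum>n=1..r. i n)\<close> by the nonzero
    \<open>j m\<close> leaves some nonzero term, whose \<open>i n\<close> must be
    \<open>j m\<close>.\<close>
  have "j m = (\<Sum>n=1..r. j m * i n)"
    using i by (simp add: indecomposable_decomposition_def flip: sum_distrib_left)
  moreover have "j m \<noteq> 0"
    using jm by (simp add: indecomposable_def)
  ultimately obtain n where "n \<in> {1..r}" "j m * i n \<noteq> 0"
    by (metis sum.neutral)
  then show "j m \<in> i ` {1..r}"
    using indecomposable_eq[OF R jm, of "i n"] i by (auto simp: indecomposable_decomposition_def)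
qed

end

theorem theorem1p1:
  fixes scale :: "rat \<Rightarrow> 'a::{ring, monoid_mult} \<Rightarrow> 'a" and Basis :: "'a set"
    and star :: "'a \<Rightarrow> 'a" and R :: "'a set"
    and r s :: nat and i j :: "nat \<Rightarrow> 'a"
  assumes "rat_algebra_involution scale Basis star"
    and "rat_algebra.is_order scale R"
    and "\<And>x. x \<noteq> 0 \<Longrightarrow> rat_algebra.left_trace scale Basis (x * star x) > 0"
    and "indecomposable_decomposition star R r i"
    and "indecomposable_decomposition star R s j"
  shows "j ` {1..s} = i ` {1..r}"
proof -
  interpret rat_algebra_involution scale Basis star by (rule assms(1))
  interpret positive_rat_algebra_involution scale Basis star
    by unfold_locales (rule assms(3))
  show ?thesis
    \<comment> \<open>The inclusion is used in both directions, with the decompositions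
      exchanged.\<close>
    using indecomposable_decomposition_subset[OF assms(2)] assms(4,5) by blast
qed

end
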